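(* For the game $\mathrm{CN}(6,4)$, the set of losing positions is, up to symmetry (rotation and reflection of the circle), $$\mathcal{L}=\{\mathbf p=(a,b,c,d,e,f)\mid a+b=d+e,\ b+c=e+f,\ a\oplus c\oplus e=0,\ \text{and } a=\min(\mathbf p)\},$$ where $a,b,c,d,e,f$ are non-negative integers. That is, a position is losing if and only if at least one of its symmetries lies in the displayed set.
   Context: For integers $1\le k\le n$, circular Nim $\mathrm{CN}(n,k)$ is the following two-player impartial game. A position is a vector $\mathbf p=(p_1,\ldots,p_n)$ of non-negative integers, the heights of $n$ stacks of tokens placed in a circle in this order (indices modulo $n$). A legal move consists of choosing $k$ cyclically consecutive stacks $i,i+1,\ldots,i+k-1$ (modulo $n$) and removing $a_j$ tokens, $0\le a_j\le p_j$, from each chosen stack $j$, with at least one token removed in total. Players alternate; a player who cannot move loses. A position is losing (belongs to $\mathcal{L}$) if the player about to move from it loses under optimal play by the opponent; equivalently, $\mathcal{L}$ is the set of positions none of whose options (positions reachable by one legal move) lies in $\mathcal{L}$. A position may be represented by $\mathbf p$ or any of its symmetries, i.e. the vectors $(p_\ell,p_{\ell+1},\ldots,p_n,p_1,\ldots,p_{\ell-1})$ and $(p_{\ell-1},p_{\ell-2},\ldots,p_1,p_n,\ldots,p_\ell)$ for $1\le \ell\le n$; sets of positions are described up to these symmetries. $\min(\mathbf p)$ is the smallest entry of $\mathbf p$, and $\oplus$ is the digital sum (Nim-sum, i.e. bitwise XOR: binary addition without carry). *)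

theory Defs
  imports Main
begin

text \<open>
  A position of \<open>CN(n,k)\<close> is a list of \<open>n\<close> stack heights, with stacks indexed from \<open>0\<close>.
  The intended parameters satisfy \<open>1 \<le> k \<le> n\<close>.
\<close>

text \<open>
  Removing \<open>a\<^sub>j\<close> tokens with \<open>0 \<le> a\<^sub>j \<le> p\<^sub>j\<close> from each chosen stack means that no stack grows and
  that the stacks outside the chosen block are unchanged; \<open>q \<noteq> p\<close> says that at least one token
  is removed.
\<close>
definition cn_move :: "nat \<Rightarrow> nat \<Rightarrow> nat list \<Rightarrow> nat list \<Rightarrow> bool" where
  "cn_move n k p q \<longleftrightarrow>
     length p = n \<and> length q = n \<and> q \<noteq> p \<and> (\<forall>j<n. q ! j \<le> p ! j) \<and>
     (\<exists>i<n. \<forall>j<n. j \<notin> {(i + t) mod n | t. t < k} \<longrightarrow> q ! j = p ! j)"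

text \<open>
  Outcome for the player about to move. The least fixed point decides every position since each
  move decreases the number of tokens; see \<open>cn_winning_iff_not_losing\<close> and \<open>cn_losing_set_iff\<close>.
\<close>
inductive cn_losing :: "nat \<Rightarrow> nat \<Rightarrow> nat list \<Rightarrow> bool"
  and cn_winning :: "nat \<Rightarrow> nat \<Rightarrow> nat list \<Rightarrow> bool"
  for n k :: nat where
  losingI: "(\<And>q. cn_move n k p q \<Longrightarrow> cn_winning n k q) \<Longrightarrow> cn_losing n k p"
| winningI: "cn_move n k p q \<Longrightarrow> cn_losing n k q \<Longrightarrow> cn_winning n k p"

text \<open>A list of the wrong length has no moves, so the length condition is needed here.\<close>
definition cn_losing_set :: "nat \<Rightarrow> nat \<Rightarrow> nat list set" where
  "cn_losing_set n k = {p. length p = n \<and> cn_losing n k p}"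

definition cn_symmetries :: "nat list \<Rightarrow> nat list set" where
  "cn_symmetries p =
     {rotate l p | l. l < length p} \<union> {rev (rotate l p) | l. l < length p}"

lemma cn_move_sum_list_less:
  assumes "cn_move n k p q"
  shows "sum_list q < sum_list p"
proof -
  have len: "length p = n" "length q = n" and ne: "q \<noteq> p" and le: "\<forall>j<n. q ! j \<le> p ! j"
    using assms by (auto simp: cn_move_def)
  from ne len obtain j where "j < n" "q ! j \<noteq> p ! j"
    by (metis nth_equalityI)
  with le have "j \<in> {0..<n}" "q ! j < p ! j"
    by (auto simp: le_neq_implies_less)
  with le have "(\<Sum>j\<in>{0..<n}. q ! j) < (\<Sum>j\<in>{0..<n}. p ! j)"
    by (intro sum_strict_mono_ex1) auto
  with len show ?thesis
    by (simp add: sum_list_sum_nth)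
qed

lemma cn_winning_iff_not_losing: "cn_winning n k p \<longleftrightarrow> \<not> cn_losing n k p"
proof (induction "sum_list p" arbitrary: p rule: less_induct)
  case less
  have IH: "cn_winning n k q \<longleftrightarrow> \<not> cn_losing n k q" if "cn_move n k p q" for q
    using less that cn_move_sum_list_less by blast
  have "cn_losing n k p \<longleftrightarrow> (\<forall>q. cn_move n k p q \<longrightarrow> cn_winning n k q)"
    by (subst cn_losing.simps) blast
  moreover have "cn_winning n k p \<longleftrightarrow> (\<exists>q. cn_move n k p q \<and> cn_losing n k q)"
    by (subst cn_winning.simps) blast
  ultimately show ?case
    using IH by blast
qed

lemma cn_losing_set_iff:
  "p \<in> cn_losing_set n k \<longleftrightarrow>
     length p = n \<and> (\<forall>q. cn_move n k p q \<longrightarrow> q \<notin> cn_losing_set n k)"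
proof -
  have "cn_losing n k p \<longleftrightarrow> (\<forall>q. cn_move n k p q \<longrightarrow> \<not> cn_losing n k q)"
    by (subst cn_losing.simps) (auto simp: cn_winning_iff_not_losing)
  thus ?thesis
    by (auto simp: cn_losing_set_def cn_move_def)
qed

end

theory Submission
  imports Defs
begin

text \<open>
  Group the stacks into the three pairs of opposite stacks \<open>(a\<^sub>i, b\<^sub>i)\<close>, where \<open>a\<^sub>1, a\<^sub>2, a\<^sub>3\<close>
  are the stacks at even places. A move leaves some \<open>a\<^sub>i\<close> and some \<open>b\<^sub>j\<close> with \<open>i \<noteq> j\<close> unchanged,
  and the dihedral group acts on the pairs as all permutations together with the exchange of
  the \<open>a\<close>s and \<open>b\<close>s. The claimed losing positions are those with \<open>b\<^sub>i = a\<^sub>i + x\<close> for a common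
  \<open>x \<ge> 0\<close> and Nim-sum of the \<open>a\<^sub>i\<close> zero (or the same with \<open>a\<close> and \<open>b\<close> exchanged).

  From such a position, keeping \<open>a\<^sub>i\<close> and \<open>b\<^sub>j\<close> forces \<open>x\<close>, then \<open>a\<^sub>i\<close>, \<open>a\<^sub>j\<close> and hence everything to
  stay. Conversely let \<open>b\<^sub>1 - a\<^sub>1 \<le> b\<^sub>2 - a\<^sub>2 \<le> b\<^sub>3 - a\<^sub>3\<close> with median difference \<open>x \<ge> 0\<close>. If
  \<open>b\<^sub>1 \<ge> x\<close>, the values \<open>b\<^sub>1 - x, a\<^sub>2, a\<^sub>3\<close> with shift \<open>x\<close> are attainable, and one of them can be
  lowered to the Nim-sum of the other two. If \<open>b\<^sub>1 < x\<close>, use the shift \<open>b\<^sub>1\<close> and the values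
  \<open>0, m, m\<close> with \<open>m = min a\<^sub>2 a\<^sub>3\<close>.
\<close>

section \<open>Opposite pairs of stacks\<close>

definition balanced :: "nat \<Rightarrow> nat \<Rightarrow> nat \<Rightarrow> nat \<Rightarrow> nat \<Rightarrow> nat \<Rightarrow> bool" where
  "balanced a1 b1 a2 b2 a3 b3 \<longleftrightarrow>
     (\<exists>x. b1 = a1 + x \<and> b2 = a2 + x \<and> b3 = a3 + x) \<and>
     Bit_Operations.xor (Bit_Operations.xor a1 a2) a3 = 0"

text \<open>The six alternatives are the six pairs of neighbouring stacks. Standing still is
  included, so \<open>reaches_balanced\<close> also covers positions that are already
  balanced.\<close>

definition keeps_adjacent ::
  "nat \<Rightarrow> nat \<Rightarrow> nat \<Rightarrow> nat \<Rightarrow> nat \<Rightarrow> nat \<Rightarrow> nat \<Rightarrow> nat \<Rightarrow> nat \<Rightarrow> nat \<Rightarrow> nat \<Rightarrow> nat \<Rightarrow> bool" where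
  "keeps_adjacent a1 b1 a2 b2 a3 b3 a1' b1' a2' b2' a3' b3' \<longleftrightarrow>
     a1' \<le> a1 \<and> b1' \<le> b1 \<and> a2' \<le> a2 \<and> b2' \<le> b2 \<and> a3' \<le> a3 \<and> b3' \<le> b3 \<and>
     (a1' = a1 \<and> b2' = b2 \<or> a1' = a1 \<and> b3' = b3 \<or> a2' = a2 \<and> b1' = b1 \<or>
      a2' = a2 \<and> b3' = b3 \<or> a3' = a3 \<and> b1' = b1 \<or> a3' = a3 \<and> b2' = b2)"

definition reaches_balanced :: "nat \<Rightarrow> nat \<Rightarrow> nat \<Rightarrow> nat \<Rightarrow> nat \<Rightarrow> nat \<Rightarrow> bool" where
  "reaches_balanced a1 b1 a2 b2 a3 b3 \<longleftrightarrow>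
     (\<exists>a1' b1' a2' b2' a3' b3'.
        keeps_adjacent a1 b1 a2 b2 a3 b3 a1' b1' a2' b2' a3' b3' \<and>
        (balanced a1' b1' a2' b2' a3' b3' \<or> balanced b1' a1' b2' a2' b3' a3'))"

section \<open>Nim with three heaps\<close>

lemma nat_xor_eq_0_iff: "Bit_Operations.xor m n = 0 \<longleftrightarrow> m = n" for m n :: nat
  by (metis xor.assoc xor.left_neutral xor.right_neutral xor_self_eq)

lemma xor_cancel_left: "Bit_Operations.xor m (Bit_Operations.xor m n) = n" for m n :: nat
  by (simp flip: xor.assoc)

text \<open>Here \<open>p\<close>, \<open>q\<close>, \<open>r\<close> are lowest bits,
  \<open>x\<close>, \<open>y\<close>, \<open>z\<close> halves and \<open>u\<close>,
  \<open>v\<close>, \<open>w\<close> their pairwise Nim-sums. A strict inequality between halves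
  survives any choice of bits; if the halves agree, the bits decide.\<close>

lemma nim_three_heaps_step:
  fixes x y z u v w :: nat
  assumes "u = z \<or> u < z \<or> v < x \<or> w < y" "u = z \<Longrightarrow> v = x \<and> w = y"
  shows "of_bool (p \<noteq> q) + 2 * u = of_bool r + 2 * z \<or>
         of_bool (p \<noteq> q) + 2 * u < of_bool r + 2 * z \<or>
         of_bool (q \<noteq> r) + 2 * v < of_bool p + 2 * x \<or>
         of_bool (p \<noteq> r) + 2 * w < of_bool q + 2 * y"
  using assms by (cases p; cases q; cases r; simp; linarith)

text \<open>Halving splits off the lowest bits. In Nim terms this supplies a winning move whenever
  the Nim-sum is nonzero.\<close>

lemma nim_three_heaps:
  fixes x y z :: nat
  shows "Bit_Operations.xor x y = z \<or> Bit_Operations.xor x y < z \<or>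
         Bit_Operations.xor y z < x \<or> Bit_Operations.xor x z < y"
proof (induction x arbitrary: y z rule: less_induct)
  case (less x)
  show ?case
  proof (cases "x = 0")
    case True
    then show ?thesis by auto
  next
    case False
    let ?X = "x div 2" and ?Y = "y div 2" and ?Z = "z div 2"
    have "Bit_Operations.xor ?X ?Y = ?Z \<or> Bit_Operations.xor ?X ?Y < ?Z \<or>
         Bit_Operations.xor ?Y ?Z < ?X \<or> Bit_Operations.xor ?X ?Z < ?Y"
      using less[of ?X ?Y ?Z] False by simp
    moreover have "Bit_Operations.xor ?Y ?Z = ?X \<and> Bit_Operations.xor ?X ?Z = ?Y"
      if "Bit_Operations.xor ?X ?Y = ?Z"
      by (metis that xor.commute xor_cancel_left)
    ultimately have "of_bool (odd x \<noteq> odd y) + 2 * Bit_Operations.xor ?X ?Y = of_bool (odd z) + 2 * ?Z \<or>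
        of_bool (odd x \<noteq> odd y) + 2 * Bit_Operations.xor ?X ?Y < of_bool (odd z) + 2 * ?Z \<or>
        of_bool (odd y \<noteq> odd z) + 2 * Bit_Operations.xor ?Y ?Z < of_bool (odd x) + 2 * ?X \<or>
        of_bool (odd x \<noteq> odd z) + 2 * Bit_Operations.xor ?X ?Z < of_bool (odd y) + 2 * ?Y"
      by (rule nim_three_heaps_step)
    moreover have "of_bool (odd n) + 2 * (n div 2) = n" for n :: nat
      by (simp flip: mod_2_eq_odd)
    ultimately show ?thesis
      by (simp only: flip: xor_rec)
  qed
qed

section \<open>Symmetry among the pairs\<close>

lemma balanced_permute:
  "balanced a2 b2 a1 b1 a3 b3 \<longleftrightarrow> balanced a1 b1 a2 b2 a3 b3"
  "balanced a1 b1 a3 b3 a2 b2 \<longleftrightarrow> balanced a1 b1 a2 b2 a3 b3"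
  "balanced a3 b3 a2 b2 a1 b1 \<longleftrightarrow> balanced a1 b1 a2 b2 a3 b3"
  "balanced a2 b2 a3 b3 a1 b1 \<longleftrightarrow> balanced a1 b1 a2 b2 a3 b3"
  "balanced a3 b3 a1 b1 a2 b2 \<longleftrightarrow> balanced a1 b1 a2 b2 a3 b3"
  by (auto simp: balanced_def ac_simps)

lemma keeps_adjacent_swap12:
  "keeps_adjacent a1 b1 a2 b2 a3 b3 a1' b1' a2' b2' a3' b3' \<Longrightarrow>
   keeps_adjacent a2 b2 a1 b1 a3 b3 a2' b2' a1' b1' a3' b3'"
  unfolding keeps_adjacent_def by (elim conjE disjE; simp)

lemma keeps_adjacent_swap23:
  "keeps_adjacent a1 b1 a2 b2 a3 b3 a1' b1' a2' b2' a3' b3' \<Longrightarrow>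
   keeps_adjacent a1 b1 a3 b3 a2 b2 a1' b1' a3' b3' a2' b2'"
  unfolding keeps_adjacent_def by (elim conjE disjE; simp)

lemma keeps_adjacent_exchange:
  "keeps_adjacent a1 b1 a2 b2 a3 b3 a1' b1' a2' b2' a3' b3' \<Longrightarrow>
   keeps_adjacent b1 a1 b2 a2 b3 a3 b1' a1' b2' a2' b3' a3'"
  unfolding keeps_adjacent_def by (elim conjE disjE; simp)

lemma reaches_balanced_swap12:
  "reaches_balanced a1 b1 a2 b2 a3 b3 \<Longrightarrow> reaches_balanced a2 b2 a1 b1 a3 b3"
  unfolding reaches_balanced_def using keeps_adjacent_swap12 balanced_permute(1) by meson

lemma reaches_balanced_swap23:
  "reaches_balanced a1 b1 a2 b2 a3 b3 \<Longrightarrow> reaches_balanced a1 b1 a3 b3 a2 b2"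
  unfolding reaches_balanced_def using keeps_adjacent_swap23 balanced_permute(2) by meson

lemma reaches_balanced_exchange:
  "reaches_balanced a1 b1 a2 b2 a3 b3 \<Longrightarrow> reaches_balanced b1 a1 b2 a2 b3 a3"
  unfolding reaches_balanced_def using keeps_adjacent_exchange by meson

section \<open>Moving to a balanced position\<close>

lemma reaches_balancedI:
  assumes "Bit_Operations.xor (Bit_Operations.xor c1 c2) c3 = 0"
    and "keeps_adjacent a1 b1 a2 b2 a3 b3 c1 (c1 + x) c2 (c2 + x) c3 (c3 + x)"
  shows "reaches_balanced a1 b1 a2 b2 a3 b3"
  using assms unfolding reaches_balanced_def balanced_def by blast

text \<open>Cross sums order the differences \<open>b\<^sub>i - a\<^sub>i\<close> without truncated
  subtraction.\<close>

lemma reaches_balanced_sorted: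
  assumes "b1 + a2 \<le> b2 + a1" "b2 + a3 \<le> b3 + a2" "a2 \<le> b2"
  shows "reaches_balanced a1 b1 a2 b2 a3 b3"
proof (cases "b2 - a2 \<le> b1")
  case True
  define x where "x = b2 - a2"
  define c where "c = b1 - x"
  have b: "b1 = c + x" "b2 = a2 + x" "c \<le> a1" "a3 + x \<le> b3"
    using True assms by (auto simp: x_def c_def)
  \<comment> \<open>The neighbours kept in the three cases are \<open>b1\<close> and
    \<open>a2\<close>, \<open>b2\<close> and \<open>a3\<close>, \<open>b1\<close> and
    \<open>a3\<close>.\<close>
  consider "Bit_Operations.xor c a2 \<le> a3" | "Bit_Operations.xor a2 a3 \<le> c"
    | "Bit_Operations.xor c a3 \<le> a2"
    using nim_three_heaps[of c a2 a3] by fastforce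
  then show ?thesis
  proof cases
    case 1
    show ?thesis
      by (rule reaches_balancedI[of c a2 "Bit_Operations.xor c a2" _ _ _ _ _ _ x])
        (use 1 b in \<open>auto simp: keeps_adjacent_def nat_xor_eq_0_iff\<close>)
  next
    case 2
    show ?thesis
      by (rule reaches_balancedI[of "Bit_Operations.xor a2 a3" a2 a3 _ _ _ _ _ _ x])
        (use 2 b in \<open>auto simp: keeps_adjacent_def xor.assoc nat_xor_eq_0_iff ac_simps\<close>)
  next
    case 3
    show ?thesis
      by (rule reaches_balancedI[of c "Bit_Operations.xor c a3" a3 _ _ _ _ _ _ x])
        (use 3 b in \<open>auto simp: keeps_adjacent_def xor_cancel_left\<close>)
  qed
next
  case False
  \<comment> \<open>Kept are \<open>b1\<close> and the smaller of \<open>a2\<close>,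
    \<open>a3\<close>. The other two differences exceed \<open>b1\<close>, which leaves room for
    this shift.\<close>
  show ?thesis
    by (rule reaches_balancedI[of 0 "min a2 a3" "min a2 a3" _ _ _ _ _ _ b1])
      (use False assms in \<open>auto simp: keeps_adjacent_def min_def\<close>)
qed

lemma reaches_balanced_nonneg_median:
  assumes "a1 \<le> b1 \<and> a2 \<le> b2 \<or> a1 \<le> b1 \<and> a3 \<le> b3 \<or> a2 \<le> b2 \<and> a3 \<le> b3"
  shows "reaches_balanced a1 b1 a2 b2 a3 b3"
proof -
  note sw = reaches_balanced_swap12 reaches_balanced_swap23
  \<comment> \<open>These are the six orders of the differences; each is sorted by permuting
    pairs.\<close>
  consider "b1 + a2 \<le> b2 + a1" "b2 + a3 \<le> b3 + a2" | "b1 + a3 \<le> b3 + a1" "b3 + a2 \<le> b2 + a3"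
    | "b2 + a1 \<le> b1 + a2" "b1 + a3 \<le> b3 + a1" | "b2 + a3 \<le> b3 + a2" "b3 + a1 \<le> b1 + a3"
    | "b3 + a1 \<le> b1 + a3" "b1 + a2 \<le> b2 + a1" | "b3 + a2 \<le> b2 + a3" "b2 + a1 \<le> b1 + a2"
    by linarith
  then show ?thesis
  proof cases
    case 1
    then show ?thesis using assms by (intro reaches_balanced_sorted) linarith+
  next
    case 2
    then have "reaches_balanced a1 b1 a3 b3 a2 b2"
      using assms by (intro reaches_balanced_sorted) linarith+
    then show ?thesis by (blast intro: sw)
  next
    case 3
    then have "reaches_balanced a2 b2 a1 b1 a3 b3"
      using assms by (intro reaches_balanced_sorted) linarith+
    then show ?thesis by (blast intro: sw)
  next
    case 4
    then have "reaches_balanced a2 b2 a3 b3 a1 b1"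
      using assms by (intro reaches_balanced_sorted) linarith+
    then show ?thesis by (blast intro: sw)
  next
    case 5
    then have "reaches_balanced a3 b3 a1 b1 a2 b2"
      using assms by (intro reaches_balanced_sorted) linarith+
    then show ?thesis by (blast intro: sw)
  next
    case 6
    then have "reaches_balanced a3 b3 a2 b2 a1 b1"
      using assms by (intro reaches_balanced_sorted) linarith+
    then show ?thesis by (blast intro: sw)
  qed
qed

lemma reaches_balanced: "reaches_balanced a1 b1 a2 b2 a3 b3"
proof (cases "a1 \<le> b1 \<and> a2 \<le> b2 \<or> a1 \<le> b1 \<and> a3 \<le> b3 \<or> a2 \<le> b2 \<and> a3 \<le> b3")
  case True
  then show ?thesis by (rule reaches_balanced_nonneg_median)
next
  case False
  \<comment> \<open>At least two differences are negative, so the exchange makes the median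
    positive.\<close>
  then have "reaches_balanced b1 a1 b2 a2 b3 a3"
    by (intro reaches_balanced_nonneg_median) linarith
  then show ?thesis by (rule reaches_balanced_exchange)
qed

section \<open>No move between balanced positions\<close>

lemma balanced_isolated:
  assumes p: "balanced a1 b1 a2 b2 a3 b3"
    and k: "keeps_adjacent a1 b1 a2 b2 a3 b3 a1' b1' a2' b2' a3' b3'"
    and q: "balanced a1' b1' a2' b2' a3' b3' \<or> balanced b1' a1' b2' a2' b3' a3'"
  shows "a1' = a1 \<and> b1' = b1 \<and> a2' = a2 \<and> b2' = b2 \<and> a3' = a3 \<and> b3' = b3"
proof -
  obtain x where x: "b1 = a1 + x" "b2 = a2 + x" "b3 = a3 + x"
    and xor: "Bit_Operations.xor (Bit_Operations.xor a1 a2) a3 = 0"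
    using p by (auto simp: balanced_def)
  from q have q': "balanced a1' b1' a2' b2' a3' b3'"
  proof
    assume "balanced b1' a1' b2' a2' b3' a3'"
    then obtain y where y: "a1' = b1' + y" "a2' = b2' + y" "a3' = b3' + y"
      and xor': "Bit_Operations.xor (Bit_Operations.xor b1' b2') b3' = 0"
      by (auto simp: balanced_def)
    \<comment> \<open>A kept \<open>b\<^sub>j\<close> gives
      \<open>b\<^sub>j + y = a\<^sub>j' \<le> a\<^sub>j = b\<^sub>j - x\<close>.\<close>
    have "y = 0" using k x y by (auto simp: keeps_adjacent_def)
    then show ?thesis using y xor' by (auto simp: balanced_def)
  qed
  then obtain y where y: "b1' = a1' + y" "b2' = a2' + y" "b3' = a3' + y"
    and xor': "Bit_Operations.xor (Bit_Operations.xor a1' a2') a3' = 0"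
    by (auto simp: balanced_def)
  \<comment> \<open>A kept \<open>a\<^sub>i\<close> gives \<open>y \<le> x\<close> through
    \<open>b\<^sub>i' \<le> b\<^sub>i\<close>; a kept \<open>b\<^sub>j\<close> gives
    \<open>x \<le> y\<close> through \<open>a\<^sub>j' \<le> a\<^sub>j\<close>.\<close>
  have "y = x"
    using k unfolding keeps_adjacent_def by (elim conjE disjE; use x y in linarith)
  then have two: "a1' = a1 \<and> a2' = a2 \<or> a1' = a1 \<and> a3' = a3 \<or> a2' = a2 \<and> a3' = a3"
    using k x y unfolding keeps_adjacent_def by auto
  then have "a1' = a1 \<and> a2' = a2 \<and> a3' = a3"
    using xor xor' by (metis nat_xor_eq_0_iff xor.commute xor_cancel_left)
  then show ?thesis using \<open>y = x\<close> x y by simp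
qed

section \<open>Translation to the circle\<close>

lemma cn_move_6_4_iff:
  "cn_move 6 4 [a, b, c, d, e, f] [a', b', c', d', e', f'] \<longleftrightarrow>
     [a', b', c', d', e', f'] \<noteq> [a, b, c, d, e, f] \<and>
     keeps_adjacent a d c f e b a' d' c' f' e' b'"
proof -
  have all: "(\<forall>j<6. P j) \<longleftrightarrow> P 0 \<and> P 1 \<and> P 2 \<and> P 3 \<and> P 4 \<and> P 5" for P :: "nat \<Rightarrow> bool"
    by (auto simp: numeral_eq_Suc All_less_Suc)
  have ex: "(\<exists>j<6. P j) \<longleftrightarrow> P 0 \<or> P 1 \<or> P 2 \<or> P 3 \<or> P 4 \<or> P 5" for P :: "nat \<Rightarrow> bool"
    by (auto simp: numeral_eq_Suc Ex_less_Suc)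
  have block: "{(i + t) mod 6 | t. t < 4} = {i mod 6, (i+1) mod 6, (i+2) mod 6, (i+3) mod 6}"
    for i :: nat
  proof -
    have "{t. t < 4} = {0, 1, 2, 3::nat}" by auto
    then show ?thesis unfolding setcompr_eq_image by simp
  qed
  \<comment> \<open>Outside a block of four lie two neighbours, one from \<open>a\<close>,
    \<open>c\<close>, \<open>e\<close> and one from \<open>d\<close>, \<open>f\<close>,
    \<open>b\<close>, never opposite each other.\<close>
  show ?thesis
    unfolding cn_move_def all ex block keeps_adjacent_def by simp argo
qed

lemma cn_symmetries_6:
  "cn_symmetries [a, b, c, d, e, f] =
     {[f, e, d, c, b, a], [a, f, e, d, c, b], [b, a, f, e, d, c],
      [c, b, a, f, e, d], [d, c, b, a, f, e], [e, d, c, b, a, f],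
      [a, b, c, d, e, f], [b, c, d, e, f, a], [c, d, e, f, a, b],
      [d, e, f, a, b, c], [e, f, a, b, c, d], [f, a, b, c, d, e]}" (is "_ = ?S")
proof -
  have "{l. l < length [a, b, c, d, e, f]} = {0, 1, 2, 3, 4, 5}" by auto
  then have "cn_symmetries [a, b, c, d, e, f] =
      (\<lambda>l. rotate l [a, b, c, d, e, f]) ` {0, 1, 2, 3, 4, 5} \<union>
      (\<lambda>l. rev (rotate l [a, b, c, d, e, f])) ` {0, 1, 2, 3, 4, 5}"
    unfolding cn_symmetries_def setcompr_eq_image by (simp only:)
  also have "\<dots> = ?S"
    unfolding image_insert image_empty by (simp add: numeral_eq_Suc del: insert_iff)
  finally show ?thesis .
qed

definition displayed :: "nat list set" where
  "displayed = {[a, b, c, d, e, f] | a b c d e f :: nat.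
                 a + b = d + e \<and> b + c = e + f \<and>
                 Bit_Operations.xor (Bit_Operations.xor a c) e = 0 \<and>
                 a = Min (set [a, b, c, d, e, f])}"

text \<open>The two equations say that \<open>d - a\<close>, \<open>f - c\<close> and
  \<open>b - e\<close> agree; \<open>a \<le> d\<close> makes this common difference a natural
  number.\<close>

lemma displayed_iff:
  "[a, b, c, d, e, f] \<in> displayed \<longleftrightarrow> balanced a d c f e b \<and> a \<le> c \<and> a \<le> e"
proof -
  have "a = Min (set [a, b, c, d, e, f]) \<longleftrightarrow> a \<le> b \<and> a \<le> c \<and> a \<le> d \<and> a \<le> e \<and> a \<le> f"
    by (auto simp: min_def)
  moreover have "a + b = d + e \<and> b + c = e + f \<and> a \<le> b \<and> a \<le> c \<and> a \<le> d \<and> a \<le> e \<and> a \<le> f \<longleftrightarrow>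
      (\<exists>x. d = a + x \<and> f = c + x \<and> b = e + x) \<and> a \<le> c \<and> a \<le> e" (is "?l \<longleftrightarrow> ?r")
  proof
    assume ?l
    then have "d = a + (d - a) \<and> f = c + (d - a) \<and> b = e + (d - a)" by linarith
    with \<open>?l\<close> show ?r by blast
  qed auto
  ultimately show ?thesis unfolding displayed_def balanced_def by blast
qed

lemma symmetry_displayed_iff:
  "(\<exists>s \<in> cn_symmetries [a, b, c, d, e, f]. s \<in> displayed) \<longleftrightarrow>
     balanced a d c f e b \<or> balanced d a f c b e"
proof -
  have perms: "balanced c f e b a d \<longleftrightarrow> balanced a d c f e b"
    "balanced e b a d c f \<longleftrightarrow> balanced a d c f e b"
    "balanced a d e b c f \<longleftrightarrow> balanced a d c f e b"
    "balanced c f a d e b \<longleftrightarrow> balanced a d c f e b"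
    "balanced e b c f a d \<longleftrightarrow> balanced a d c f e b"
    "balanced f c b e d a \<longleftrightarrow> balanced d a f c b e"
    "balanced b e d a f c \<longleftrightarrow> balanced d a f c b e"
    "balanced d a b e f c \<longleftrightarrow> balanced d a f c b e"
    "balanced f c d a b e \<longleftrightarrow> balanced d a f c b e"
    "balanced b e f c d a \<longleftrightarrow> balanced d a f c b e"
    by (rule balanced_permute)+
  \<comment> \<open>Some symmetry brings a smallest entry of either triangle to the front, so the
    minimality condition disappears.\<close>
  have min: "a \<le> c \<and> a \<le> e \<or> c \<le> a \<and> c \<le> e \<or> e \<le> a \<and> e \<le> c"
    "b \<le> d \<and> b \<le> f \<or> d \<le> b \<and> d \<le> f \<or> f \<le> b \<and> f \<le> d"
    by linarith+
  show ?thesis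
    unfolding cn_symmetries_6 bex_simps displayed_iff perms using min by argo
qed

text \<open>Moves lower the token total, so induction on it shows that the move graph has only one
  kernel.\<close>

lemma cn_losing_set_eqI:
  assumes len: "\<And>p. p \<in> A \<Longrightarrow> length p = n"
    and stable: "\<And>p q. p \<in> A \<Longrightarrow> q \<in> A \<Longrightarrow> \<not> cn_move n k p q"
    and absorbing: "\<And>p. length p = n \<Longrightarrow> p \<notin> A \<Longrightarrow> \<exists>q \<in> A. cn_move n k p q"
  shows "cn_losing_set n k = A"
proof -
  have "p \<in> cn_losing_set n k \<longleftrightarrow> p \<in> A" for p
  proof (induction "sum_list p" arbitrary: p rule: less_induct)
    case less
    then have IH: "q \<in> cn_losing_set n k \<longleftrightarrow> q \<in> A" if "cn_move n k p q" for q
      using that cn_move_sum_list_less by blast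
    show ?case
      using IH len stable absorbing cn_losing_set_iff by metis
  qed
  then show ?thesis by blast
qed

theorem theorem3p5:
  shows "cn_losing_set 6 4 =
    {p. \<exists>s \<in> cn_symmetries p.
          s \<in> {[a, b, c, d, e, f] | a b c d e f :: nat.
                 a + b = d + e \<and> b + c = e + f \<and>
                 Bit_Operations.xor (Bit_Operations.xor a c) e = 0 \<and>
                 a = Min (set [a, b, c, d, e, f])}}"
proof -
  let ?A = "{p. \<exists>s \<in> cn_symmetries p. s \<in> displayed}"
  have six: "\<exists>a b c d e f. p = [a, b, c, d, e, f]" if "length p = 6" for p :: "nat list"
    using that by (auto simp: numeral_eq_Suc length_Suc_conv)
  have len: "length p = 6" if "p \<in> ?A" for p
  proof -
    from that obtain s where "s \<in> cn_symmetries p" "s \<in> displayed" by blast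
    moreover from this have "length s = length p" by (auto simp: cn_symmetries_def)
    ultimately show ?thesis by (auto simp: displayed_def)
  qed
  have "cn_losing_set 6 4 = ?A"
  proof (rule cn_losing_set_eqI)
    fix p assume "p \<in> ?A"
    then show "length p = 6" by (rule len)
  next
    fix p q assume p: "p \<in> ?A" and q: "q \<in> ?A"
    obtain a b c d e f where p_eq: "p = [a, b, c, d, e, f]" using six len p by blast
    obtain a' b' c' d' e' f' where q_eq: "q = [a', b', c', d', e', f']" using six len q by blast
    have bp: "balanced a d c f e b \<or> balanced d a f c b e"
      using p by (simp add: p_eq symmetry_displayed_iff)
    have bq: "balanced a' d' c' f' e' b' \<or> balanced d' a' f' c' b' e'"
      using q by (simp add: q_eq symmetry_displayed_iff)
    show "\<not> cn_move 6 4 p q"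
    proof
      assume "cn_move 6 4 p q"
      then have ne: "q \<noteq> p" and k: "keeps_adjacent a d c f e b a' d' c' f' e' b'"
        by (auto simp: p_eq q_eq cn_move_6_4_iff)
      from k have "keeps_adjacent d a f c b e d' a' f' c' b' e'"
        by (rule keeps_adjacent_exchange)
      with bp bq k have "q = p"
        using balanced_isolated[of a d c f e b a' d' c' f' e' b']
          balanced_isolated[of d a f c b e d' a' f' c' b' e'] unfolding p_eq q_eq by blast
      with ne show False ..
    qed
  next
    fix p :: "nat list" assume "length p = 6" and p: "p \<notin> ?A"
    then obtain a b c d e f where p_eq: "p = [a, b, c, d, e, f]" using six by blast
    obtain a' d' c' f' e' b' where k: "keeps_adjacent a d c f e b a' d' c' f' e' b'"
      and bq: "balanced a' d' c' f' e' b' \<or> balanced d' a' f' c' b' e'"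
      using reaches_balanced[of a d c f e b] unfolding reaches_balanced_def by blast
    let ?q = "[a', b', c', d', e', f']"
    have q: "?q \<in> ?A" using bq by (simp add: symmetry_displayed_iff)
    \<comment> \<open>This rules out standing still, which \<open>reaches_balanced\<close>
      permits.\<close>
    with p have "?q \<noteq> p" by blast
    with k have "cn_move 6 4 p ?q" by (simp add: p_eq cn_move_6_4_iff)
    with q show "\<exists>q \<in> ?A. cn_move 6 4 p q" by blast
  qed
  then show ?thesis unfolding displayed_def .
qed

end
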